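(* The logic $L_{\rm OMP}$ is algebraizable in the sense of Blok and Pigozzi.
   Context: $L_{\rm OMP}$ is the deductive system in the language $\{\rightarrow,0\}$ ($\rightarrow$ binary, $0$ a constant), with $\neg\varphi:=\varphi\rightarrow0$, whose consequence relation $\vdash$ is given by the axioms (B1) $\vdash\varphi\rightarrow(\psi\rightarrow\varphi)$; (B2) $\vdash\varphi\rightarrow\varphi$; (B3) $\vdash\neg\neg\varphi\approx\varphi$; (B4) $\vdash0\rightarrow\varphi$; (B5) $\vdash(\neg\varphi\rightarrow\varphi)\rightarrow\varphi$; and the rules (MP) $\varphi,\varphi\rightarrow\psi\vdash\psi$; (Sf) $\varphi\rightarrow\psi\vdash(\psi\rightarrow\chi)\rightarrow(\varphi\rightarrow\chi)$; (R1) $\varphi\rightarrow\psi,\psi\rightarrow\varphi\vdash\varphi\approx\psi$; (R2) $\varphi\rightarrow\psi\vdash(\neg((\neg\psi\rightarrow\varphi)\rightarrow\varphi)\rightarrow\varphi)\rightarrow\varphi\approx\psi$; (R3) $\varphi\rightarrow\neg\psi\vdash\varphi\rightarrow((\varphi\rightarrow\psi)\rightarrow\psi)$; (R4) $\varphi\rightarrow\neg\psi\vdash\psi\rightarrow((\varphi\rightarrow\psi)\rightarrow\psi)$; (R5) $\varphi\rightarrow\neg\psi,\varphi\rightarrow\chi,\psi\rightarrow\chi\vdash((\varphi\rightarrow\psi)\rightarrow\psi)\rightarrow\chi$. A deductive system is algebraizable (Blok–Pigozzi) if there are a class $\mathcal K$ of algebras, a finite set of defining identities $\delta(p)\approx\varepsilon(p)$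 in one variable and a finite set $\Delta(p,q)$ of formulas in two variables such that $\Gamma\vdash\varphi$ iff $\{\delta(\psi)\approx\varepsilon(\psi)\mid\psi\in\Gamma\}\models_{\mathcal K}\delta(\varphi)\approx\varepsilon(\varphi)$, and $\varphi\approx\psi$ and $\delta(\varphi\Delta\psi)\approx\varepsilon(\varphi\Delta\psi)$ are mutually $\mathcal K$-consequences of each other. (The paper intends $\Delta(p,q)=\{p\rightarrow q,q\rightarrow p\}$ and defining identity $p\approx p\rightarrow p$.) *)

theory Defs
  imports Main "HOL-Library.Infinite_Typeclass"
begin

section \<open>Formulas\<close>

datatype form = Var nat | Zero ("\<zero>") | Imp form form (infixr "\<rightarrow>" 65)

abbreviation Neg :: "form \<Rightarrow> form" ("\<sim> _" [70] 70)
  where "\<sim> \<phi> \<equiv> \<phi> \<rightarrow> \<zero>"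

primrec vars :: "form \<Rightarrow> nat set" where
  "vars (Var n) = {n}"
| "vars \<zero> = {}"
| "vars (\<phi> \<rightarrow> \<psi>) = vars \<phi> \<union> vars \<psi>"

primrec subst :: "(nat \<Rightarrow> form) \<Rightarrow> form \<Rightarrow> form" where
  "subst \<sigma> (Var n) = \<sigma> n"
| "subst \<sigma> \<zero> = \<zero>"
| "subst \<sigma> (\<phi> \<rightarrow> \<psi>) = subst \<sigma> \<phi> \<rightarrow> subst \<sigma> \<psi>"


section \<open>The logic of orthomodular posets\<close>

text \<open>
  The axioms and rules derive formulas as well as identities \<open>\<phi> \<approx> \<psi>\<close>, so derivability has the
  two judgements \<open>\<Gamma> \<turnstile> \<phi>\<close> and \<open>\<Gamma> \<turnstile> \<phi> \<approx> \<psi>\<close>; the premises \<open>\<Gamma>\<close> are formulas.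
  The rules \<open>eq_refl\<close> to \<open>eq_mp\<close> express that \<open>\<approx>\<close> is identity: an equivalence, compatible with
  the connective, under which a derived formula may be replaced by an identical one.
  If \<open>\<phi> \<approx> \<psi>\<close> merely abbreviated the pair \<open>\<phi> \<rightarrow> \<psi>\<close>, \<open>\<psi> \<rightarrow> \<phi>\<close>, then R1 would be void and
  \<open>\<phi> \<rightarrow> \<psi>, \<psi> \<rightarrow> \<phi> \<turnstile> (\<chi> \<rightarrow> \<phi>) \<rightarrow> (\<chi> \<rightarrow> \<psi>)\<close> would not be derivable.
\<close>

inductive
  L_OMP :: "form set \<Rightarrow> form \<Rightarrow> bool" ("_ \<turnstile> _" [51, 51] 50) and
  L_OMP_eq :: "form set \<Rightarrow> form \<Rightarrow> form \<Rightarrow> bool" ("_ \<turnstile> _ \<approx> _" [51, 51, 51] 50)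
  for \<Gamma> :: "form set"
where
  prem: "\<phi> \<in> \<Gamma> \<Longrightarrow> \<Gamma> \<turnstile> \<phi>"
| B1: "\<Gamma> \<turnstile> \<phi> \<rightarrow> (\<psi> \<rightarrow> \<phi>)"
| B2: "\<Gamma> \<turnstile> \<phi> \<rightarrow> \<phi>"
| B3: "\<Gamma> \<turnstile> \<sim> (\<sim> \<phi>) \<approx> \<phi>"
| B4: "\<Gamma> \<turnstile> \<zero> \<rightarrow> \<phi>"
| B5: "\<Gamma> \<turnstile> (\<sim> \<phi> \<rightarrow> \<phi>) \<rightarrow> \<phi>"
| MP: "\<Gamma> \<turnstile> \<phi> \<Longrightarrow> \<Gamma> \<turnstile> \<phi> \<rightarrow> \<psi> \<Longrightarrow> \<Gamma> \<turnstile> \<psi>"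
| Sf: "\<Gamma> \<turnstile> \<phi> \<rightarrow> \<psi> \<Longrightarrow> \<Gamma> \<turnstile> (\<psi> \<rightarrow> \<chi>) \<rightarrow> (\<phi> \<rightarrow> \<chi>)"
| R1: "\<Gamma> \<turnstile> \<phi> \<rightarrow> \<psi> \<Longrightarrow> \<Gamma> \<turnstile> \<psi> \<rightarrow> \<phi> \<Longrightarrow> \<Gamma> \<turnstile> \<phi> \<approx> \<psi>"
| R2: "\<Gamma> \<turnstile> \<phi> \<rightarrow> \<psi> \<Longrightarrow> \<Gamma> \<turnstile> ((\<sim> ((\<sim> \<psi> \<rightarrow> \<phi>) \<rightarrow> \<phi>) \<rightarrow> \<phi>) \<rightarrow> \<phi>) \<approx> \<psi>"
| R3: "\<Gamma> \<turnstile> \<phi> \<rightarrow> \<sim> \<psi> \<Longrightarrow> \<Gamma> \<turnstile> \<phi> \<rightarrow> ((\<phi> \<rightarrow> \<psi>) \<rightarrow> \<psi>)"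
| R4: "\<Gamma> \<turnstile> \<phi> \<rightarrow> \<sim> \<psi> \<Longrightarrow> \<Gamma> \<turnstile> \<psi> \<rightarrow> ((\<phi> \<rightarrow> \<psi>) \<rightarrow> \<psi>)"
| R5: "\<Gamma> \<turnstile> \<phi> \<rightarrow> \<sim> \<psi> \<Longrightarrow> \<Gamma> \<turnstile> \<phi> \<rightarrow> \<chi> \<Longrightarrow> \<Gamma> \<turnstile> \<psi> \<rightarrow> \<chi> \<Longrightarrow>
     \<Gamma> \<turnstile> ((\<phi> \<rightarrow> \<psi>) \<rightarrow> \<psi>) \<rightarrow> \<chi>"
| eq_refl: "\<Gamma> \<turnstile> \<phi> \<approx> \<phi>"
| eq_sym: "\<Gamma> \<turnstile> \<phi> \<approx> \<psi> \<Longrightarrow> \<Gamma> \<turnstile> \<psi> \<approx> \<phi>"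
| eq_trans: "\<Gamma> \<turnstile> \<phi> \<approx> \<psi> \<Longrightarrow> \<Gamma> \<turnstile> \<psi> \<approx> \<chi> \<Longrightarrow> \<Gamma> \<turnstile> \<phi> \<approx> \<chi>"
| eq_cong: "\<Gamma> \<turnstile> \<phi> \<approx> \<phi>' \<Longrightarrow> \<Gamma> \<turnstile> \<psi> \<approx> \<psi>' \<Longrightarrow> \<Gamma> \<turnstile> (\<phi> \<rightarrow> \<psi>) \<approx> (\<phi>' \<rightarrow> \<psi>')"
| eq_mp: "\<Gamma> \<turnstile> \<phi> \<Longrightarrow> \<Gamma> \<turnstile> \<phi> \<approx> \<psi> \<Longrightarrow> \<Gamma> \<turnstile> \<psi>"


section \<open>Algebras and equational consequence\<close>

record 'u alg =
  carrier :: "'u set"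
  imp :: "'u \<Rightarrow> 'u \<Rightarrow> 'u"
  zero :: "'u"

definition algebra :: "'u alg \<Rightarrow> bool" where
  "algebra A \<longleftrightarrow> zero A \<in> carrier A \<and>
     (\<forall>x \<in> carrier A. \<forall>y \<in> carrier A. imp A x y \<in> carrier A)"

primrec eval :: "'u alg \<Rightarrow> (nat \<Rightarrow> 'u) \<Rightarrow> form \<Rightarrow> 'u" where
  "eval A v (Var n) = v n"
| "eval A v \<zero> = zero A"
| "eval A v (\<phi> \<rightarrow> \<psi>) = imp A (eval A v \<phi>) (eval A v \<psi>)"

text \<open>A pair of formulas \<open>(s, t)\<close> stands for the identity \<open>s \<approx> t\<close>.\<close>

type_synonym identity = "form \<times> form"

definition satisfies :: "'u alg \<Rightarrow> (nat \<Rightarrow> 'u) \<Rightarrow> identity \<Rightarrow> bool" where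
  "satisfies A v e \<longleftrightarrow> eval A v (fst e) = eval A v (snd e)"

definition eq_conseq :: "'u alg set \<Rightarrow> identity set \<Rightarrow> identity set \<Rightarrow> bool" where
  "eq_conseq K E F \<longleftrightarrow>
     (\<forall>A \<in> K. \<forall>v. range v \<subseteq> carrier A \<longrightarrow>
        (\<forall>e \<in> E. satisfies A v e) \<longrightarrow> (\<forall>e \<in> F. satisfies A v e))"


section \<open>Algebraizability\<close>

text \<open>
  A one-variable formula uses \<open>Var 0\<close>, a two-variable formula \<open>Var 0\<close> and \<open>Var 1\<close>.
  For the set \<open>T\<close> of defining identities \<open>\<delta>(p) \<approx> \<epsilon>(p)\<close>, \<open>inst1 T \<phi>\<close> is the set of all
  \<open>\<delta>(\<phi>) \<approx> \<epsilon>(\<phi>)\<close>; \<open>inst2 \<Delta> \<phi> \<psi>\<close> is the set \<open>\<phi> \<Delta> \<psi>\<close>.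
\<close>

definition inst1 :: "identity set \<Rightarrow> form \<Rightarrow> identity set" where
  "inst1 T \<phi> = (\<lambda>(\<delta>, \<epsilon>). (subst (\<lambda>_. \<phi>) \<delta>, subst (\<lambda>_. \<phi>) \<epsilon>)) ` T"

definition inst2 :: "form set \<Rightarrow> form \<Rightarrow> form \<Rightarrow> form set" where
  "inst2 \<Delta> \<phi> \<psi> = subst (\<lambda>n. if n = 0 then \<phi> else \<psi>) ` \<Delta>"

definition algebraizable_by ::
  "(form set \<Rightarrow> form \<Rightarrow> bool) \<Rightarrow> 'u alg set \<Rightarrow> identity set \<Rightarrow> form set \<Rightarrow> bool" where
  "algebraizable_by L K T \<Delta> \<longleftrightarrow>
     (\<forall>A \<in> K. algebra A) \<and>
     finite T \<and> (\<forall>(\<delta>, \<epsilon>) \<in> T. vars \<delta> \<subseteq> {0} \<and> vars \<epsilon> \<subseteq> {0}) \<and>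
     finite \<Delta> \<and> (\<forall>\<chi> \<in> \<Delta>. vars \<chi> \<subseteq> {0, 1}) \<and>
     (\<forall>\<Gamma> \<phi>. L \<Gamma> \<phi> \<longleftrightarrow> eq_conseq K (\<Union>\<psi>\<in>\<Gamma>. inst1 T \<psi>) (inst1 T \<phi>)) \<and>
     (\<forall>\<phi> \<psi>. eq_conseq K {(\<phi>, \<psi>)} (\<Union>\<chi>\<in>inst2 \<Delta> \<phi> \<psi>. inst1 T \<chi>) \<and>
             eq_conseq K (\<Union>\<chi>\<in>inst2 \<Delta> \<phi> \<psi>. inst1 T \<chi>) {(\<phi>, \<psi>)})"

text \<open>
  A class of algebras is a set of algebras whose elements are drawn from a type \<open>'u\<close>.
  There are only countably many variables, so \<open>eq_conseq K\<close> depends only on the countable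
  subalgebras of members of \<open>K\<close>; hence any infinite \<open>'u\<close> is large enough, and the definition
  does not depend on which one is taken.
\<close>

definition algebraizable :: "'u::infinite itself \<Rightarrow> (form set \<Rightarrow> form \<Rightarrow> bool) \<Rightarrow> bool" where
  "algebraizable _ L \<longleftrightarrow> (\<exists>(K :: 'u alg set) T \<Delta>. algebraizable_by L K T \<Delta>)"

end

(* Algebraizing class: the Lindenbaum algebras of all theories, with defining identity p = p -> p
   and Delta = {p -> q, q -> p}. Since v ranges over classes of formulas, it is a substitution sigma
   composed with the quotient map, so soundness reduces to closure of derivability under substitution
   and cut, while completeness is read off from the Lindenbaum algebra of Gamma itself. *)
theory Submission
  imports Defs "HOL-Library.Countable"
begin

text \<open>All axioms and rules are schematic, so a substitution turns each step into an instance
  of the same rule. Only \<open>prem\<close> uses the assumption on \<Gamma>', which is where cut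
  enters.\<close>

lemma L_OMP_subst:
  shows "\<Gamma> \<turnstile> \<phi> \<Longrightarrow> (\<And>\<gamma>. \<gamma> \<in> \<Gamma> \<Longrightarrow> \<Gamma>' \<turnstile> subst \<sigma> \<gamma>) \<Longrightarrow> \<Gamma>' \<turnstile> subst \<sigma> \<phi>"
    and "\<Gamma> \<turnstile> \<phi> \<approx> \<psi> \<Longrightarrow> (\<And>\<gamma>. \<gamma> \<in> \<Gamma> \<Longrightarrow> \<Gamma>' \<turnstile> subst \<sigma> \<gamma>) \<Longrightarrow>
      \<Gamma>' \<turnstile> subst \<sigma> \<phi> \<approx> subst \<sigma> \<psi>"
  by (induction rule: L_OMP_L_OMP_eq.inducts) (auto intro: L_OMP_L_OMP_eq.intros)

text \<open>From left to right, congruence identifies the theorem \<phi> \<rightarrow> \<phi> with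
  each of the two implications, and \<open>eq_mp\<close> transfers derivability. The converse is
  R1.\<close>

lemma L_OMP_eq_iff: "\<Gamma> \<turnstile> \<phi> \<approx> \<psi> \<longleftrightarrow> \<Gamma> \<turnstile> \<phi> \<rightarrow> \<psi> \<and> \<Gamma> \<turnstile> \<psi> \<rightarrow> \<phi>"
  by (meson L_OMP_L_OMP_eq.B2 R1 eq_cong eq_mp eq_refl eq_sym)

text \<open>If \<phi> is derivable, B1 with MP gives (\<phi> \<rightarrow> \<phi>) \<rightarrow>
  \<phi>, and the reverse implication is itself an instance of B1. Conversely, \<phi> inherits
  derivability from \<phi> \<rightarrow> \<phi>.\<close>

lemma L_OMP_iff_eq: "\<Gamma> \<turnstile> \<phi> \<longleftrightarrow> \<Gamma> \<turnstile> \<phi> \<approx> (\<phi> \<rightarrow> \<phi>)"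
  by (meson B1 L_OMP_L_OMP_eq.B2 L_OMP_eq_iff MP eq_mp eq_sym)

instance form :: countable
  by countable_datatype

definition enc :: "form \<Rightarrow> 'u::infinite" where
  "enc = (SOME f. inj f)"

lemma inj_enc: "inj (enc :: form \<Rightarrow> 'u::infinite)"
proof -
  obtain f :: "nat \<Rightarrow> 'u" where "inj f"
    using infinite_countable_subset[OF infinite_UNIV] by blast
  then have "inj (f \<circ> (to_nat :: form \<Rightarrow> nat))"
    by (simp add: inj_compose)
  then show ?thesis
    unfolding enc_def by (rule someI[where P = inj])
qed

text \<open>Algebra elements must lie in the given type 'u, so a class is represented by the code of
  one chosen member instead of by a set of formulas.\<close>

definition cls :: "form set \<Rightarrow> form \<Rightarrow> 'u::infinite" where
  "cls \<Gamma> \<phi> = enc (SOME \<psi>. \<Gamma> \<turnstile> \<phi> \<approx> \<psi>)"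

definition lindenbaum :: "form set \<Rightarrow> 'u::infinite alg" where
  "lindenbaum \<Gamma> = \<lparr>carrier = range (cls \<Gamma>),
     imp = (\<lambda>x y. cls \<Gamma> (inv enc x \<rightarrow> inv enc y)), zero = cls \<Gamma> \<zero>\<rparr>"

lemma inv_enc_cls: "\<Gamma> \<turnstile> \<phi> \<approx> inv enc (cls \<Gamma> \<phi> :: 'u::infinite)"
  unfolding cls_def inv_f_f[OF inj_enc] by (rule someI) (rule eq_refl)

lemma cls_eq_iff: "(cls \<Gamma> \<phi> :: 'u::infinite) = cls \<Gamma> \<psi> \<longleftrightarrow> \<Gamma> \<turnstile> \<phi> \<approx> \<psi>"
proof
  assume "(cls \<Gamma> \<phi> :: 'u) = cls \<Gamma> \<psi>"
  then show "\<Gamma> \<turnstile> \<phi> \<approx> \<psi>"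
    by (metis inv_enc_cls eq_sym eq_trans)
next
  assume "\<Gamma> \<turnstile> \<phi> \<approx> \<psi>"
  \<comment> \<open>Equality of the predicates, not just equivalence of the formulas, makes
    \<open>SOME\<close> pick the same representative.\<close>
  then have "(\<lambda>\<chi>. \<Gamma> \<turnstile> \<phi> \<approx> \<chi>) = (\<lambda>\<chi>. \<Gamma> \<turnstile> \<psi> \<approx> \<chi>)"
    by (meson eq_sym eq_trans)
  then show "(cls \<Gamma> \<phi> :: 'u) = cls \<Gamma> \<psi>"
    by (simp add: cls_def)
qed

lemma algebra_lindenbaum: "algebra (lindenbaum \<Gamma>)"
  by (simp add: algebra_def lindenbaum_def)

text \<open>In the implication case \<open>imp\<close> decodes to chosen representatives, which may
  differ from the substituted subformulas but are identical to them modulo \<Gamma>; congruence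
  closes the gap.\<close>

lemma eval_lindenbaum:
  "eval (lindenbaum \<Gamma>) (\<lambda>n. cls \<Gamma> (\<sigma> n) :: 'u::infinite) \<phi> = cls \<Gamma> (subst \<sigma> \<phi>)"
  by (induction \<phi>) (auto simp: lindenbaum_def cls_eq_iff intro: eq_cong eq_sym inv_enc_cls)

lemma subst_Var: "subst Var \<phi> = \<phi>"
  by (induction \<phi>) auto

lemma eq_conseq_lindenbaum:
  "eq_conseq (range lindenbaum :: 'u::infinite alg set) E F \<longleftrightarrow>
     (\<forall>\<Gamma> \<sigma>. (\<forall>(s, t) \<in> E. \<Gamma> \<turnstile> subst \<sigma> s \<approx> subst \<sigma> t) \<longrightarrow>
            (\<forall>(s, t) \<in> F. \<Gamma> \<turnstile> subst \<sigma> s \<approx> subst \<sigma> t))"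
proof -
  have sat: "satisfies (lindenbaum \<Gamma>) (\<lambda>n. cls \<Gamma> (\<sigma> n) :: 'u) e \<longleftrightarrow>
      (case e of (s, t) \<Rightarrow> \<Gamma> \<turnstile> subst \<sigma> s \<approx> subst \<sigma> t)" for \<Gamma> \<sigma> e
    by (simp add: satisfies_def eval_lindenbaum cls_eq_iff split_beta)
  have val: "range v \<subseteq> carrier (lindenbaum \<Gamma>) \<longleftrightarrow> (\<exists>\<sigma>. v = (\<lambda>n. cls \<Gamma> (\<sigma> n)))"
    for \<Gamma> and v :: "nat \<Rightarrow> 'u"
  proof
    assume "range v \<subseteq> carrier (lindenbaum \<Gamma>)"
    then have "\<forall>n. \<exists>\<phi>. v n = cls \<Gamma> \<phi>"
      by (auto simp: lindenbaum_def)
    then show "\<exists>\<sigma>. v = (\<lambda>n. cls \<Gamma> (\<sigma> n))"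
      by metis
  qed (auto simp: lindenbaum_def)
  have "eq_conseq (range lindenbaum :: 'u alg set) E F \<longleftrightarrow>
     (\<forall>\<Gamma> \<sigma>. (\<forall>e \<in> E. satisfies (lindenbaum \<Gamma>) (\<lambda>n. cls \<Gamma> (\<sigma> n) :: 'u) e) \<longrightarrow>
            (\<forall>e \<in> F. satisfies (lindenbaum \<Gamma>) (\<lambda>n. cls \<Gamma> (\<sigma> n) :: 'u) e))"
    unfolding eq_conseq_def ball_simps val by blast
  then show ?thesis
    unfolding sat .
qed

theorem theorem3p3:
  shows "algebraizable TYPE('u::infinite) L_OMP"
proof -
  define K where "K = (range lindenbaum :: 'u alg set)"
  define T where "T = {(Var 0, Var 0 \<rightarrow> Var 0)}"
  define \<Delta> where "\<Delta> = {Var 0 \<rightarrow> Var 1, Var 1 \<rightarrow> Var 0}"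
  have inst1: "inst1 T \<phi> = {(\<phi>, \<phi> \<rightarrow> \<phi>)}" for \<phi>
    by (simp add: inst1_def T_def)
  have inst2: "inst2 \<Delta> \<phi> \<psi> = {\<phi> \<rightarrow> \<psi>, \<psi> \<rightarrow> \<phi>}" for \<phi> \<psi>
    by (simp add: inst2_def \<Delta>_def)
  have "\<Gamma> \<turnstile> \<phi> \<longleftrightarrow> eq_conseq K (\<Union>\<psi>\<in>\<Gamma>. inst1 T \<psi>) (inst1 T \<phi>)" for \<Gamma> \<phi>
  proof -
    have "eq_conseq K (\<Union>\<psi>\<in>\<Gamma>. inst1 T \<psi>) (inst1 T \<phi>) \<longleftrightarrow>
        (\<forall>\<Gamma>' \<sigma>. (\<forall>\<psi>\<in>\<Gamma>. \<Gamma>' \<turnstile> subst \<sigma> \<psi>) \<longrightarrow> \<Gamma>' \<turnstile> subst \<sigma> \<phi>)"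
      by (simp add: K_def inst1 eq_conseq_lindenbaum flip: L_OMP_iff_eq)
    \<comment> \<open>Left to right, take \<Gamma>' = \<Gamma> and \<sigma> = \<open>Var\<close>;
      right to left is substitution with cut.\<close>
    also have "\<dots> \<longleftrightarrow> \<Gamma> \<turnstile> \<phi>"
      by (metis L_OMP_subst(1) prem subst_Var)
    finally show ?thesis by simp
  qed
  \<comment> \<open>Once the defining identities are read as derivability, both directions become
    \<open>L_OMP_eq_iff\<close> for the substituted formulas.\<close>
  moreover have "eq_conseq K {(\<phi>, \<psi>)} (\<Union>\<chi>\<in>inst2 \<Delta> \<phi> \<psi>. inst1 T \<chi>)"
    and "eq_conseq K (\<Union>\<chi>\<in>inst2 \<Delta> \<phi> \<psi>. inst1 T \<chi>) {(\<phi>, \<psi>)}" for \<phi> \<psi>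
    by (simp_all add: K_def inst1 inst2 eq_conseq_lindenbaum flip: L_OMP_iff_eq)
      (auto simp: L_OMP_eq_iff)
  ultimately have "algebraizable_by L_OMP K T \<Delta>"
    unfolding algebraizable_by_def
    by (auto simp: K_def T_def \<Delta>_def algebra_lindenbaum)
  then show ?thesis
    unfolding algebraizable_def by blast
qed

end
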